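(* There exists an absolute constant $c>0$ such that the following holds. Let $x=\sum_{j=1}^N\lambda_jV_j\in\mathbb{R}^d$ where $V\in\mathbb{R}^{d\times N}$ has columns $V_1,\ldots,V_N$ and $\lambda\in\mathbb{R}^N$ satisfies $\mathbf{1}^{\top}\lambda=1$, $\lambda\ge0$. Let $\|\cdot\|$ be a norm such that $(\mathbb{R}^d,\|\cdot\|)$ is $(2,D)$-smooth. Let $\varepsilon>0$ and write $R=\max\{DR_v,R_\lambda\}$ where $R_v=\max_i\|\lambda_iV_i\|$ and $R_\lambda=\max_i|\lambda_i|$. Then there exist a subset $\mathcal{J}\subset\{1,\ldots,N\}$ of size $$|\mathcal{J}|=\min\left\{N,\ \left\lceil 1+N\,\frac{c\,(\sqrt{N}R/\varepsilon)^2}{1+c\,(\sqrt{N}R/\varepsilon)^2}\right\rceil\right\}$$ and coefficients $\mu_j\ge0$, $j\in\mathcal{J}$, such that $\hat{x}=\sum_{j\in\mathcal{J}}\mu_jV_j$ satisfies $$\|x-\hat{x}\|\le\varepsilon\qquad\text{and}\qquad\left|\sum_{j\in\mathcal{J}}\mu_j-1\right|\le\varepsilon.$$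
   Context: A Banach space $(\mathcal{B},\|\cdot\|)$ is $(2,D)$-smooth, for $D>0$, if $\|x+y\|^2+\|x-y\|^2\le2\|x\|^2+2D^2\|y\|^2$ for all $x,y\in\mathcal{B}$. $\lceil\cdot\rceil$ denotes the ceiling. *)

theory Defs
  imports Complex_Main "Jordan_Normal_Form.Matrix"
begin

(* R^d is carrier_vec d, so that the dimension is an ordinary natural number and can be
   quantified inside the scope of an absolute constant. Functions on real vec are only
   constrained on carrier_vec d. *)

definition is_norm :: "nat \<Rightarrow> (real vec \<Rightarrow> real) \<Rightarrow> bool" where
  "is_norm d nrm \<longleftrightarrow>
     (\<forall>x\<in>carrier_vec d. 0 \<le> nrm x) \<and>
     (\<forall>x\<in>carrier_vec d. nrm x = 0 \<longleftrightarrow> x = 0\<^sub>v d) \<and>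
     (\<forall>a. \<forall>x\<in>carrier_vec d. nrm (a \<cdot>\<^sub>v x) = \<bar>a\<bar> * nrm x) \<and>
     (\<forall>x\<in>carrier_vec d. \<forall>y\<in>carrier_vec d. nrm (x + y) \<le> nrm x + nrm y)"

(* (2,D)-smoothness of the Banach space (R^d, nrm). Completeness is not listed because
   every norm on R^d is complete. *)

definition two_smooth :: "nat \<Rightarrow> (real vec \<Rightarrow> real) \<Rightarrow> real \<Rightarrow> bool" where
  "two_smooth d nrm D \<longleftrightarrow>
     0 < D \<and> is_norm d nrm \<and>
     (\<forall>x\<in>carrier_vec d. \<forall>y\<in>carrier_vec d.
        (nrm (x + y))\<^sup>2 + (nrm (x - y))\<^sup>2 \<le> 2 * (nrm x)\<^sup>2 + 2 * D\<^sup>2 * (nrm y)\<^sup>2)"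

definition lin_comb :: "nat \<Rightarrow> real mat \<Rightarrow> (nat \<Rightarrow> real) \<Rightarrow> nat set \<Rightarrow> real vec" where
  "lin_comb d V a J = finsum_vec TYPE(real) d (\<lambda>j. a j \<cdot>\<^sub>v col V j) J"

end

theory Submission
  imports Defs "HOL-Library.Function_Algebras"
begin

text \<open>
  The support is sampled without replacement, but derandomised. Put \<open>u\<^sub>j = \<lambda>\<^sub>j V\<^sub>j\<close>, let \<open>J\<close> be
  an \<open>m\<close>-element subset of the \<open>N\<close> indices and use the weights \<open>\<mu>\<^sub>j = (N/m) \<lambda>\<^sub>j\<close>. Then
  \<open>x - \<Sum>\<^sub>J \<mu>\<^sub>j V\<^sub>j = -(N/m) S\<^sub>J\<close>, where the deviation \<open>S\<^sub>J = \<Sum>\<^sub>J u - (m/N) \<Sum> u\<close> compares the partial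
  sum with its expectation under uniform sampling. The numbers \<open>\<lambda>\<^sub>j\<close> themselves, with the absolute
  value as norm, obey the same calculus, and their deviation is the error in \<open>\<Sum>\<mu>\<^sub>j = 1\<close>.

  If \<open>n = N - m\<close> indices remain, adding one of them, \<open>j\<close>, turns \<open>S\<^sub>J\<close> into
  \<open>((n-1)/n) S\<^sub>J + w\<^sub>j\<close>, where \<open>w\<^sub>j\<close> is \<open>u\<^sub>j\<close> minus the average of the remaining vectors, so that
  the \<open>w\<^sub>j\<close> sum to zero (\<open>deviation_insert\<close>). In a \<open>(2,D)\<close>-smooth space a perturbation with mean
  zero raises the mean square of the norm by at most \<open>2 D\<^sup>2\<close> times its own mean square
  (\<open>sum_perturbation_le\<close>). Averaged over \<open>j\<close>, a step therefore contracts \<open>\<parallel>S\<^sub>J\<parallel>\<^sup>2\<close> by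
  \<open>((n-1)/n)\<^sup>2\<close> and adds at most \<open>8 D\<^sup>2 max \<parallel>u\<^sub>j\<parallel>\<^sup>2\<close>. The contraction is what makes the error
  vanish as \<open>m\<close> approaches \<open>N\<close>: the solution of this recursion is of order \<open>m (N-m)/N\<close>, whereas
  sampling with replacement only gives order \<open>m\<close>.

  The averaged inequalities for the vectors and for the weights can be added, so that a single
  \<open>j\<close> is good for both. Greedy choice thus produces a \<open>J\<close> of every size \<open>m < N\<close> for which both
  errors are at most the square root of \<open>32 R\<^sup>2 N (N-m)/m\<close>. With \<open>c = 32\<close> the prescribed size is
  just what makes this at most \<open>\<epsilon>\<close>.
\<close>

section \<open>Smooth seminorms and centred perturbations\<close>

text \<open>The scalar multiplication is a parameter because one of the two instances below lives on
  functions \<open>nat \<Rightarrow> real\<close>. Definiteness is left out: a norm on \<open>d\<close>-dimensional vectors, pulled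
  back to all functions, ignores the entries from \<open>d\<close> on.\<close>

locale smooth_seminorm = vector_space scale
  for scale :: "real \<Rightarrow> 'a::ab_group_add \<Rightarrow> 'a" (infixr \<open>*s\<close> 75) +
  fixes p :: "'a \<Rightarrow> real" and D :: real
  assumes p_scale: "p (c *s x) = \<bar>c\<bar> * p x"
    and p_triangle: "p (x + y) \<le> p x + p y"
    and p_smooth: "(p (x + y))\<^sup>2 + (p (x - y))\<^sup>2 \<le> 2 * (p x)\<^sup>2 + 2 * D\<^sup>2 * (p y)\<^sup>2"
begin

lemma p_zero: "p 0 = 0"
  using p_scale[of 0 0] by simp

lemma p_minus: "p (- x) = p x"
  using p_scale[of "-1" x] by simp

lemma p_nonneg: "0 \<le> p x"
  using p_triangle[of x "- x"] by (simp add: p_zero p_minus)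

lemma p_diff_le: "p (x - y) \<le> p x + p y"
  using p_triangle[of x "- y"] by (simp add: p_minus)

lemma p_sum_le: "p (\<Sum>j\<in>K. w j) \<le> (\<Sum>j\<in>K. p (w j))"
proof (induction K rule: infinite_finite_induct)
  case (insert j K)
  then show ?case using p_triangle[of "w j" "sum w K"] by simp
qed (auto simp: p_zero)

lemma sum_centred_ge:
  assumes "(\<Sum>j\<in>K. w j) = 0"
  shows "real (card K) * (p x)\<^sup>2 \<le> (\<Sum>j\<in>K. (p (x - w j))\<^sup>2)"
proof -
  have "(\<Sum>j\<in>K. x - w j) = real (card K) *s x"
    using assms by (simp add: sum_subtractf sum_constant_scale)
  then have mean: "real (card K) * p x \<le> (\<Sum>j\<in>K. p (x - w j))"
    using p_sum_le[of "\<lambda>j. x - w j" K] by (simp add: p_scale)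
  \<comment> \<open>Jensen's inequality for the square, from its tangent line at \<open>p x\<close>.\<close>
  have "(\<Sum>j\<in>K. 2 * p x * p (x - w j) - (p x)\<^sup>2) \<le> (\<Sum>j\<in>K. (p (x - w j))\<^sup>2)"
  proof (rule sum_mono)
    fix j
    show "2 * p x * p (x - w j) - (p x)\<^sup>2 \<le> (p (x - w j))\<^sup>2"
      using zero_le_power2[of "p (x - w j) - p x"] by (simp add: power2_diff algebra_simps)
  qed
  moreover have "(\<Sum>j\<in>K. 2 * p x * p (x - w j) - (p x)\<^sup>2)
      = 2 * p x * (\<Sum>j\<in>K. p (x - w j)) - real (card K) * (p x)\<^sup>2"
    by (simp add: sum_subtractf sum_distrib_left)
  moreover have "2 * p x * (real (card K) * p x) \<le> 2 * p x * (\<Sum>j\<in>K. p (x - w j))"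
    using mean p_nonneg by (intro mult_left_mono) auto
  ultimately show ?thesis by (simp add: power2_eq_square algebra_simps)
qed

text \<open>Smoothness bounds the sum over \<open>x + w\<^sub>j\<close> and \<open>x - w\<^sub>j\<close> together; since the \<open>w\<^sub>j\<close> are centred,
  the second half is already at least \<open>card K\<close> times \<open>(p x)\<^sup>2\<close>.\<close>

lemma sum_perturbation_le:
  assumes "(\<Sum>j\<in>K. w j) = 0"
  shows "(\<Sum>j\<in>K. (p (x + w j))\<^sup>2) \<le> real (card K) * (p x)\<^sup>2 + 2 * D\<^sup>2 * (\<Sum>j\<in>K. (p (w j))\<^sup>2)"
proof -
  have "(\<Sum>j\<in>K. (p (x + w j))\<^sup>2 + (p (x - w j))\<^sup>2)
      \<le> (\<Sum>j\<in>K. 2 * (p x)\<^sup>2 + 2 * D\<^sup>2 * (p (w j))\<^sup>2)"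
    by (rule sum_mono) (rule p_smooth)
  then show ?thesis
    using sum_centred_ge[OF assms, of x] by (simp add: sum.distrib sum_distrib_left)
qed

end

section \<open>Deviation of a partial sum\<close>

definition deviation ::
    "(real \<Rightarrow> 'a \<Rightarrow> 'a) \<Rightarrow> ('i \<Rightarrow> 'a::ab_group_add) \<Rightarrow> 'i set \<Rightarrow> 'i set \<Rightarrow> 'a" where
  "deviation scale u I J = sum u J - scale (real (card J) / real (card I)) (sum u I)"

context smooth_seminorm
begin

lemma deviation_insert:
  fixes u :: "'i \<Rightarrow> 'a"
  assumes "finite I" "J \<subseteq> I" "j \<in> I - J"
  defines "n \<equiv> real (card (I - J))"
  shows "deviation (*s) u I (insert j J)
      = ((n - 1) / n) *s deviation (*s) u I J + (u j - (1 / n) *s sum u (I - J))"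
proof -
  define U Y N m where "U = sum u I" and "Y = sum u J"
    and "N = real (card I)" and "m = real (card J)"
  have fJ: "finite J" using assms finite_subset by blast
  have rest: "sum u (I - J) = U - Y"
    unfolding U_def Y_def using assms by (simp add: sum_diff)
  have "card J \<le> card I" using assms by (simp add: card_mono)
  then have N: "N = n + m"
    unfolding N_def m_def n_def using assms fJ by (simp add: card_Diff_subset)
  have n: "n > 0" unfolding n_def using assms by (auto simp: card_gt_0_iff)
  have m: "m \<ge> 0" unfolding m_def by simp
  have coeff: "(m + 1) / N = (n - 1) / n * (m / N) + 1 / n"
    unfolding N using n m add_pos_nonneg[OF n m]
    by (simp add: divide_simps) (simp add: algebra_simps)
  have "Y = ((n - 1) / n + 1 / n) *s Y" using n by (simp add: add_divide_distrib[symmetric])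
  then have Y: "((n - 1) / n) *s Y + (1 / n) *s Y = Y" by (simp add: scale_left_distrib)
  have "deviation (*s) u I (insert j J) = u j + Y - ((m + 1) / N) *s U"
    unfolding deviation_def using assms fJ by (simp add: U_def Y_def N_def m_def add.commute)
  also have "\<dots> = ((n - 1) / n) *s (Y - (m / N) *s U) + (u j - (1 / n) *s (U - Y))"
    unfolding coeff by (subst Y[symmetric]) (simp add: scale_left_distrib scale_right_diff_distrib)
  finally show ?thesis
    unfolding rest by (simp add: deviation_def U_def Y_def N_def m_def)
qed

text \<open>The constant 8 is the product of the 2 from \<open>sum_perturbation_le\<close> and of \<open>2\<^sup>2\<close>, because
  subtracting an average of the \<open>u\<^sub>j\<close> at most doubles the bound \<open>r\<close>.\<close>

lemma sum_deviation_insert_le: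
  fixes u :: "'i \<Rightarrow> 'a"
  assumes "finite I" "J \<subset> I" and r: "\<And>j. j \<in> I \<Longrightarrow> p (u j) \<le> r"
  defines "n \<equiv> real (card (I - J))"
  shows "(\<Sum>j\<in>I - J. (p (deviation (*s) u I (insert j J)))\<^sup>2)
      \<le> n * (((n - 1) / n)\<^sup>2 * (p (deviation (*s) u I J))\<^sup>2 + 8 * D\<^sup>2 * r\<^sup>2)"
proof -
  define K where "K = I - J"
  define w where "w j = u j - (1 / n) *s sum u K" for j
  define S where "S = deviation (*s) u I J"
  have n: "n > 0" unfolding n_def using assms by (auto simp: card_gt_0_iff)
  have "n *s (1 / n) *s sum u K = sum u K" using n by simp
  then have centred: "(\<Sum>j\<in>K. w j) = 0"
    unfolding w_def by (simp add: sum_subtractf sum_constant_scale n_def K_def)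
  have "p (sum u K) \<le> n * r"
    using p_sum_le[of u K] sum_bounded_above[of K "\<lambda>j. p (u j)" r] r
    unfolding n_def K_def by force
  then have avg: "p ((1 / n) *s sum u K) \<le> r"
    using n by (simp add: p_scale field_simps)
  have w: "(p (w j))\<^sup>2 \<le> 4 * r\<^sup>2" if "j \<in> K" for j
  proof -
    have "p (w j) \<le> 2 * r"
      using p_diff_le[of "u j" "(1 / n) *s sum u K"] r[of j] avg that
      unfolding w_def K_def by auto
    then show ?thesis using power_mono[OF _ p_nonneg, of "w j" "2 * r" 2] by (simp add: power_mult_distrib)
  qed
  have "(\<Sum>j\<in>K. (p (deviation (*s) u I (insert j J)))\<^sup>2)
      = (\<Sum>j\<in>K. (p (((n - 1) / n) *s S + w j))\<^sup>2)"
    using assms unfolding S_def w_def K_def n_def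
    by (intro sum.cong refl) (subst deviation_insert; auto)
  also have "\<dots> \<le> n * (p (((n - 1) / n) *s S))\<^sup>2 + 2 * D\<^sup>2 * (\<Sum>j\<in>K. (p (w j))\<^sup>2)"
    using sum_perturbation_le[OF centred] by (simp add: n_def K_def)
  also have "\<dots> \<le> n * (p (((n - 1) / n) *s S))\<^sup>2 + 2 * D\<^sup>2 * (n * (4 * r\<^sup>2))"
    using sum_bounded_above[of K "\<lambda>j. (p (w j))\<^sup>2" "4 * r\<^sup>2"] w
    by (intro add_left_mono mult_left_mono) (auto simp: n_def K_def)
  also have "\<dots> = n * (((n - 1) / n)\<^sup>2 * (p S)\<^sup>2 + 8 * D\<^sup>2 * r\<^sup>2)"
    by (simp only: p_scale power_mult_distrib power2_abs) (simp add: algebra_simps)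
  finally show ?thesis unfolding S_def K_def .
qed

end

section \<open>Greedy selection\<close>

text \<open>With \<open>n = N - m\<close>, a step that contracts by \<open>((n-1)/n)\<^sup>2\<close> raises the profile \<open>m (N - m)/N\<close>
  by exactly \<open>(n-1)/n\<close> beyond the contraction. This is at least one half unless the step would
  exhaust the index set, so 16 times the profile absorbs the additive constant 8 of a step.\<close>

lemma profile_step:
  fixes m n :: real
  assumes "0 \<le> m" "2 \<le> n"
  shows "((n - 1) / n)\<^sup>2 * (m * n / (m + n)) + 1 / 2 \<le> (m + 1) * (n - 1) / (m + n)"
proof -
  have "(m + 1) * (n - 1) / (m + n) - ((n - 1) / n)\<^sup>2 * (m * n / (m + n)) = (n - 1) / n"
    using assms by (simp add: power2_eq_square divide_simps) (simp add: algebra_simps)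
  moreover have "1 / 2 \<le> (n - 1) / n" using assms by (simp add: field_simps)
  ultimately show ?thesis by linarith
qed

text \<open>Two families over the same index set are handled at once because a single \<open>J\<close> has to serve
  both: the vectors, and the weights whose sum must stay near 1.\<close>

theorem exists_small_deviation:
  fixes u :: "'i \<Rightarrow> 'a::ab_group_add" and v :: "'i \<Rightarrow> 'b::ab_group_add"
  assumes "smooth_seminorm sc p D" "smooth_seminorm sc' q E"
    and fin: "finite I"
    and r: "\<And>j. j \<in> I \<Longrightarrow> p (u j) \<le> r" and s: "\<And>j. j \<in> I \<Longrightarrow> q (v j) \<le> s"
    and "m < card I"
  shows "\<exists>J\<subseteq>I. card J = m \<and>
      (p (deviation sc u I J))\<^sup>2 + (q (deviation sc' v I J))\<^sup>2
      \<le> 16 * (D\<^sup>2 * r\<^sup>2 + E\<^sup>2 * s\<^sup>2) * (real m * real (card I - m) / real (card I))"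
  using \<open>m < card I\<close>
proof (induction m)
  case 0
  interpret P: smooth_seminorm sc p D by fact
  interpret Q: smooth_seminorm sc' q E by fact
  show ?case by (intro exI[of _ "{}"]) (simp add: deviation_def P.p_zero Q.p_zero)
next
  case (Suc m)
  interpret P: smooth_seminorm sc p D by fact
  interpret Q: smooth_seminorm sc' q E by fact
  define F where "F J = (p (deviation sc u I J))\<^sup>2 + (q (deviation sc' v I J))\<^sup>2" for J
  define B where "B = D\<^sup>2 * r\<^sup>2 + E\<^sup>2 * s\<^sup>2"
  define n where "n = real (card I - m)"
  have n: "n \<ge> 2" "real (card I) = real m + n" "real (card I - Suc m) = n - 1"
    using Suc.prems unfolding n_def by auto
  have B: "B \<ge> 0" unfolding B_def by simp
  obtain J where J: "J \<subseteq> I" "card J = m"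
      and "F J \<le> 16 * B * (real m * real (card I - m) / real (card I))"
    using Suc.IH[OF Suc_lessD[OF Suc.prems]] unfolding F_def B_def by blast
  then have FJ: "F J \<le> 16 * B * (real m * n / (real m + n))"
    by (simp only: n(2) n_def[symmetric])
  have card: "real (card (I - J)) = n"
    using J fin finite_subset[of J I] unfolding n_def by (simp add: card_Diff_subset)
  have "J \<subset> I" using J Suc.prems by auto
  have "(\<Sum>j\<in>I - J. F (insert j J)) \<le> n * (((n - 1) / n)\<^sup>2 * F J + 8 * B)"
    using P.sum_deviation_insert_le[where u = u, OF fin \<open>J \<subset> I\<close> r]
      Q.sum_deviation_insert_le[where u = v, OF fin \<open>J \<subset> I\<close> s]
    unfolding F_def B_def card sum.distrib by (simp add: algebra_simps)
  then have "\<exists>j\<in>I - J. F (insert j J) \<le> ((n - 1) / n)\<^sup>2 * F J + 8 * B"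
    using sum_strict_mono[of "I - J" "\<lambda>_. ((n - 1) / n)\<^sup>2 * F J + 8 * B" "\<lambda>j. F (insert j J)"]
      \<open>J \<subset> I\<close> fin card unfolding sum_constant
    by (metis Diff_eq_empty_iff finite_Diff linorder_not_le psubset_eq subset_antisym)
  then obtain j where j: "j \<in> I - J" and Fj: "F (insert j J) \<le> ((n - 1) / n)\<^sup>2 * F J + 8 * B"
    by blast
  note Fj
  also have "((n - 1) / n)\<^sup>2 * F J + 8 * B
      \<le> 16 * B * (((n - 1) / n)\<^sup>2 * (real m * n / (real m + n)) + 1 / 2)"
    using mult_left_mono[OF FJ, of "((n - 1) / n)\<^sup>2"] by (simp add: algebra_simps)
  also have "\<dots> \<le> 16 * B * ((real m + 1) * (n - 1) / (real m + n))"
    using profile_step[of "real m" n] n B by (intro mult_left_mono) auto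
  finally have "F (insert j J) \<le> 16 * B * (real (Suc m) * real (card I - Suc m) / real (card I))"
    using n by (simp add: add.commute)
  moreover have "insert j J \<subseteq> I" "card (insert j J) = Suc m"
    using j J fin finite_subset[of J I] by auto
  ultimately show ?case unfolding F_def B_def by blast
qed

section \<open>Column vectors as functions\<close>

lemma lin_comb_eq_vec:
  assumes V: "V \<in> carrier_mat d N" and J: "J \<subseteq> {..<N}"
  shows "lin_comb d V a J = vec d (\<lambda>i. \<Sum>j\<in>J. a j * V $$ (i, j))"
proof -
  have fin: "finite J" using J finite_subset by blast
  have closed: "(\<lambda>j. a j \<cdot>\<^sub>v col V j) \<in> J \<rightarrow> carrier_vec d" using V by auto
  have "lin_comb d V a J \<in> carrier_vec d"
    unfolding lin_comb_def by (rule finsum_vec_closed[OF closed])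
  moreover have "(a j \<cdot>\<^sub>v col V j) $ i = a j * V $$ (i, j)" if "i < d" "j \<in> J" for i j
    using V J that by (auto simp: subset_iff)
  ultimately show ?thesis
    unfolding lin_comb_def by (intro eq_vecI) (auto simp: index_finsum_vec[OF fin _ closed])
qed

lemma sum_fun_apply: "(\<Sum>j\<in>A. f j) i = (\<Sum>j\<in>A. f j i)"
  by (induction A rule: infinite_finite_induct) auto

lemma smooth_seminorm_vec:
  assumes "two_smooth d nrm D"
  shows "smooth_seminorm (\<lambda>c f i. c * f i) (\<lambda>f. nrm (vec d f)) D"
proof -
  have add: "vec d (f + g) = vec d f + vec d g" and diff: "vec d (f - g) = vec d f - vec d g"
    and smult: "vec d (\<lambda>i. c * f i) = c \<cdot>\<^sub>v vec d f" for f g :: "nat \<Rightarrow> real" and c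
    by (auto intro!: eq_vecI)
  show ?thesis
    using assms unfolding two_smooth_def is_norm_def
    by unfold_locales (auto simp: fun_eq_iff algebra_simps add diff smult)
qed

lemma smooth_seminorm_abs: "smooth_seminorm (*) (abs :: real \<Rightarrow> real) 1"
  by unfold_locales (auto simp: algebra_simps abs_mult power2_eq_square)

section \<open>Sparse approximation of convex combinations\<close>

text \<open>The prescribed size solves the error bound for \<open>m\<close>: with \<open>k = 32 N R\<^sup>2/\<epsilon>\<^sup>2\<close>, the squared error
  of the greedy set is at most \<open>\<epsilon>\<^sup>2 k (N - m)/m\<close>.\<close>

lemma size_imp_error_le:
  fixes k m N :: real
  assumes "0 \<le> k" "0 < m" "N * (k / (1 + k)) \<le> m"
  shows "k * (N - m) / m \<le> 1"
proof -
  have "(1 + k) * (N * (k / (1 + k))) = N * k" using assms by simp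
  moreover have "(1 + k) * (N * (k / (1 + k))) \<le> (1 + k) * m"
    using assms by (intro mult_left_mono) auto
  ultimately show ?thesis using assms by (simp add: field_simps)
qed

lemma sparse_approximation:
  assumes V: "V \<in> carrier_mat d N"
    and sum1: "(\<Sum>j<N. lam $ j) = 1" and nonneg: "\<forall>j<N. 0 \<le> lam $ j"
    and smooth: "two_smooth d nrm D" and "eps > 0"
    and DRv: "\<And>j. j < N \<Longrightarrow> D * nrm (lam $ j \<cdot>\<^sub>v col V j) \<le> R"
    and Rl: "\<And>j. j < N \<Longrightarrow> \<bar>lam $ j\<bar> \<le> R"
    and m: "0 < m" "m < N"
      "real N * ((32 * (sqrt (real N) * R / eps)\<^sup>2) / (1 + 32 * (sqrt (real N) * R / eps)\<^sup>2))
        \<le> real m"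
  shows "\<exists>J mu. J \<subseteq> {..<N} \<and> card J = m \<and> (\<forall>j\<in>J. 0 \<le> mu j) \<and>
      nrm (lin_comb d V (\<lambda>j. lam $ j) {..<N} - lin_comb d V mu J) \<le> eps \<and>
      \<bar>(\<Sum>j\<in>J. mu j) - 1\<bar> \<le> eps"
proof -
  define u where "u j i = lam $ j * V $$ (i, j)" for j i
  define p where "p = (\<lambda>f. nrm (vec d f))"
  interpret P: smooth_seminorm "\<lambda>c f i. c * f i" p D
    unfolding p_def using smooth by (rule smooth_seminorm_vec)
  have D: "D > 0" using smooth by (simp add: two_smooth_def)
  have "vec d (u j) = lam $ j \<cdot>\<^sub>v col V j" if "j < N" for j
    using V that by (intro eq_vecI) (auto simp: u_def)
  then have pu: "p (u j) \<le> R / D" if "j \<in> {..<N}" for j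
    using DRv[of j] D that by (simp add: p_def field_simps)
  \<comment> \<open>Vectors and weights each contribute \<open>R\<^sup>2\<close>: their radii are \<open>R / D\<close> and \<open>R\<close>, and their
    smoothness constants are \<open>D\<close> and 1.\<close>
  obtain J where J: "J \<subseteq> {..<N}" "card J = m"
    and dev: "(p (deviation (\<lambda>c f i. c * f i) u {..<N} J))\<^sup>2
        + \<bar>deviation (*) (\<lambda>j. lam $ j) {..<N} J\<bar>\<^sup>2
      \<le> 16 * (D\<^sup>2 * (R / D)\<^sup>2 + 1\<^sup>2 * R\<^sup>2) * (real m * real (N - m) / real N)"
    using exists_small_deviation[OF P.smooth_seminorm_axioms smooth_seminorm_abs,
        of "{..<N}" u "R / D" "\<lambda>j. lam $ j" R m] pu Rl m by auto
  define S where "S = deviation (\<lambda>c f i. c * f i) u {..<N} J"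
  define t where "t = deviation (*) (\<lambda>j. lam $ j) {..<N} J"
  define a where "a = real N / real m"
  have a: "a > 0" unfolding a_def using m by simp
  define k where "k = 32 * (sqrt (real N) * R / eps)\<^sup>2"
  have "16 * (D\<^sup>2 * (R / D)\<^sup>2 + 1\<^sup>2 * R\<^sup>2) = 32 * R\<^sup>2"
    using D by (simp add: power_divide)
  then have "a\<^sup>2 * ((p S)\<^sup>2 + \<bar>t\<bar>\<^sup>2) \<le> a\<^sup>2 * (32 * R\<^sup>2 * (real m * real (N - m) / real N))"
    using dev unfolding S_def t_def by (intro mult_left_mono) auto
  also have "\<dots> = eps\<^sup>2 * (k * (real N - real m) / real m)"
    unfolding a_def k_def using m \<open>eps > 0\<close>
    by (simp add: power_mult_distrib power_divide of_nat_diff) (simp add: field_simps power2_eq_square)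
  also have "\<dots> \<le> eps\<^sup>2"
  proof -
    have "k * (real N - real m) / real m \<le> 1"
      using m by (intro size_imp_error_le) (auto simp: k_def)
    then show ?thesis by (rule mult_left_le) simp
  qed
  finally have bound: "(a * p S)\<^sup>2 + (a * \<bar>t\<bar>)\<^sup>2 \<le> eps\<^sup>2"
    by (simp add: power_mult_distrib distrib_left)
  define mu where "mu j = a * lam $ j" for j
  have "lin_comb d V (\<lambda>j. lam $ j) {..<N} - lin_comb d V mu J = vec d (\<lambda>i. - a * S i)"
    unfolding lin_comb_eq_vec[OF V order_refl] lin_comb_eq_vec[OF V J(1)]
    using m J by (intro eq_vecI)
      (auto simp: S_def deviation_def u_def mu_def a_def sum_fun_apply sum_distrib_left field_simps)
  then have "nrm (lin_comb d V (\<lambda>j. lam $ j) {..<N} - lin_comb d V mu J) = a * p S"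
    using P.p_scale[of "- a" S] a by (simp add: p_def)
  moreover have "(\<Sum>j\<in>J. mu j) - 1 = a * t"
  proof -
    have "(\<Sum>j\<in>J. mu j) = a * (\<Sum>j\<in>J. lam $ j)" by (simp add: mu_def sum_distrib_left)
    then show ?thesis
      using m J sum1 by (simp add: t_def deviation_def a_def right_diff_distrib)
  qed
  moreover have "a * p S \<le> eps" "a * \<bar>t\<bar> \<le> eps"
    using bound \<open>eps > 0\<close> zero_le_power2[of "a * p S"] zero_le_power2[of "a * \<bar>t\<bar>"]
    by - (rule power2_le_imp_le; linarith)+
  moreover have "\<forall>j\<in>J. 0 \<le> mu j" using nonneg J a by (auto simp: mu_def)
  ultimately show ?thesis using J a by (intro exI[of _ J] exI[of _ mu]) (simp add: abs_mult)
qed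

theorem theorem6p3:
  "\<exists>c::real. c > 0 \<and>
     (\<forall>(d::nat) (N::nat) V lam x nrm (D::real) (eps::real) (Rv::real) (Rl::real) (R::real).
        V \<in> carrier_mat d N \<longrightarrow>
        lam \<in> carrier_vec N \<longrightarrow>
        (\<Sum>j<N. lam $ j) = 1 \<longrightarrow>
        (\<forall>j<N. 0 \<le> lam $ j) \<longrightarrow>
        x = lin_comb d V (\<lambda>j. lam $ j) {..<N} \<longrightarrow>
        is_norm d nrm \<longrightarrow>
        two_smooth d nrm D \<longrightarrow>
        eps > 0 \<longrightarrow>
        Rv = Max ((\<lambda>i. nrm (lam $ i \<cdot>\<^sub>v col V i)) ` {..<N}) \<longrightarrow>
        Rl = Max ((\<lambda>i. \<bar>lam $ i\<bar>) ` {..<N}) \<longrightarrow>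
        R = max (D * Rv) Rl \<longrightarrow>
        (\<exists>(J::nat set) (mu::nat \<Rightarrow> real).
           J \<subseteq> {..<N} \<and>
           int (card J) =
             min (int N)
               \<lceil>1 + real N * ((c * (sqrt (real N) * R / eps)\<^sup>2) /
                               (1 + c * (sqrt (real N) * R / eps)\<^sup>2))\<rceil> \<and>
           (\<forall>j\<in>J. 0 \<le> mu j) \<and>
           nrm (x - lin_comb d V mu J) \<le> eps \<and>
           \<bar>(\<Sum>j\<in>J. mu j) - 1\<bar> \<le> eps))"
proof (rule exI[of _ "32::real"], intro conjI allI impI, goal_cases)
  case 1
  show ?case by simp
next
  case (2 d N V lam x nrm D eps Rv Rl R)
  define T where "T = 1 + real N * ((32 * (sqrt (real N) * R / eps)\<^sup>2) /
                               (1 + 32 * (sqrt (real N) * R / eps)\<^sup>2))"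
  have "T \<ge> 1" unfolding T_def by simp
  show ?case
  proof (cases "int N \<le> \<lceil>T\<rceil>")
    case True
    have "x - x = 0\<^sub>v d"
      using 2 lin_comb_eq_vec[OF 2(1) order_refl] by (auto intro!: eq_vecI)
    moreover have "nrm (0\<^sub>v d) = 0" using 2(6) by (simp add: is_norm_def)
    ultimately show ?thesis
      using 2 True unfolding T_def
      by (intro exI[of _ "{..<N}"] exI[of _ "\<lambda>j. lam $ j"]) auto
  next
    case False
    define m where "m = nat \<lceil>T\<rceil>"
    have m: "int m = \<lceil>T\<rceil>" "0 < m" "m < N" "T \<le> real m"
      using False \<open>T \<ge> 1\<close> unfolding m_def by linarith+
    have "D * nrm (lam $ j \<cdot>\<^sub>v col V j) \<le> R" if "j < N" for j
    proof -
      have "nrm (lam $ j \<cdot>\<^sub>v col V j) \<le> Rv" using that 2(9) by simp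
      moreover have "D > 0" using 2(7) by (simp add: two_smooth_def)
      ultimately have "D * nrm (lam $ j \<cdot>\<^sub>v col V j) \<le> D * Rv" by simp
      then show ?thesis using 2(11) by simp
    qed
    moreover have "\<bar>lam $ j\<bar> \<le> R" if "j < N" for j
    proof -
      have "\<bar>lam $ j\<bar> \<le> Rl" using that 2(10) by simp
      then show ?thesis using 2(11) by simp
    qed
    moreover have "real N * ((32 * (sqrt (real N) * R / eps)\<^sup>2) /
        (1 + 32 * (sqrt (real N) * R / eps)\<^sup>2)) \<le> real m"
      using m(4) unfolding T_def by linarith
    ultimately obtain J mu where "J \<subseteq> {..<N}" "card J = m" "\<forall>j\<in>J. 0 \<le> mu j"
        "nrm (x - lin_comb d V mu J) \<le> eps" "\<bar>(\<Sum>j\<in>J. mu j) - 1\<bar> \<le> eps"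
      using sparse_approximation[OF 2(1,3,4,7,8) _ _ m(2,3)] 2(5) by blast
    then show ?thesis
      using m False unfolding T_def[symmetric] by (intro exI[of _ J] exI[of _ mu]) auto
  qed
qed

end
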